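(* Let $k$ be a field, let $N$ be a positive integer and let $M$ be a proper divisor of $N$ (so $1 \le M < N$ and $M \mid N$). Let $$\mathcal{A}_{N,M} = \Big\{ A = (a_{ij}) \in \mathrm{Mat}_N(k) \;\Big|\; \sum_{1 \le i \le N,\; i \equiv r \ (\mathrm{mod}\ M)} a_{ij} = 0 \quad \text{for all } r = 1, \ldots, M \text{ and all } j = 1, \ldots, N \Big\},$$ regarded as an associative algebra under matrix multiplication. Let $\lambda_1, \ldots, \lambda_N \in k$ be such that, for all $i, j \in \{1, \ldots, N\}$, $\lambda_i = \lambda_j$ if and only if $\left[\frac{i}{M}\right] = \left[\frac{j}{M}\right]$. Then the bilinear form on $\mathcal{A}_{N,M}$ given by $$(x, y) = \mathrm{tr}\big([x,y] \cdot \mathrm{diag}(\lambda_1, \ldots, \lambda_N)\big), \qquad x, y \in \mathcal{A}_{N,M},$$ is non-degenerate, i.e., the algebra $\mathcal{A}_{N,M}$ equipped with this form is anti-Frobenius.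
   Context: $\mathrm{Mat}_N(k)$ denotes the algebra of $N \times N$ matrices over $k$, with rows and columns indexed by $1, \ldots, N$; $[x,y] = xy - yx$ is the matrix commutator; $\mathrm{tr}$ is the trace; $\mathrm{diag}(\lambda_1,\ldots,\lambda_N)$ is the diagonal matrix with the given entries; $[t]$ applied to a number $t$ denotes its integer part (floor). Algebras are associative and not required to have a unit. An associative algebra $\mathcal{A}$ is called anti-Frobenius if it is equipped with a non-degenerate anti-symmetric bilinear form $(\cdot,\cdot)$ such that $(x, yz) + (y, zx) + (z, xy) = 0$ for all $x, y, z \in \mathcal{A}$. *)

theory Defs
  imports
    "Jordan_Normal_Form.VS_Connect"
    "HOL-Number_Theory.Cong"
begin

(* An algebra is a HOL-Algebra module record whose mult field is the product.
   Algebras need not have a unit, so the field one of the record is unconstrained. *)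
locale assoc_algebra = vectorspace K A
  for K :: "('k, 'm) ring_scheme" and A :: "('k, 'a, 'n) module_scheme" +
  assumes mult_closed:
      "\<lbrakk>x \<in> carrier A; y \<in> carrier A\<rbrakk> \<Longrightarrow> x \<otimes>\<^bsub>A\<^esub> y \<in> carrier A"
    and mult_assoc:
      "\<lbrakk>x \<in> carrier A; y \<in> carrier A; z \<in> carrier A\<rbrakk>
        \<Longrightarrow> (x \<otimes>\<^bsub>A\<^esub> y) \<otimes>\<^bsub>A\<^esub> z = x \<otimes>\<^bsub>A\<^esub> (y \<otimes>\<^bsub>A\<^esub> z)"
    and mult_add_left:
      "\<lbrakk>x \<in> carrier A; y \<in> carrier A; z \<in> carrier A\<rbrakk>
        \<Longrightarrow> (x \<oplus>\<^bsub>A\<^esub> y) \<otimes>\<^bsub>A\<^esub> z = x \<otimes>\<^bsub>A\<^esub> z \<oplus>\<^bsub>A\<^esub> y \<otimes>\<^bsub>A\<^esub> z"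
    and mult_add_right:
      "\<lbrakk>x \<in> carrier A; y \<in> carrier A; z \<in> carrier A\<rbrakk>
        \<Longrightarrow> z \<otimes>\<^bsub>A\<^esub> (x \<oplus>\<^bsub>A\<^esub> y) = z \<otimes>\<^bsub>A\<^esub> x \<oplus>\<^bsub>A\<^esub> z \<otimes>\<^bsub>A\<^esub> y"
    and mult_smult_left:
      "\<lbrakk>c \<in> carrier K; x \<in> carrier A; y \<in> carrier A\<rbrakk>
        \<Longrightarrow> (c \<odot>\<^bsub>A\<^esub> x) \<otimes>\<^bsub>A\<^esub> y = c \<odot>\<^bsub>A\<^esub> (x \<otimes>\<^bsub>A\<^esub> y)"
    and mult_smult_right:
      "\<lbrakk>c \<in> carrier K; x \<in> carrier A; y \<in> carrier A\<rbrakk>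
        \<Longrightarrow> x \<otimes>\<^bsub>A\<^esub> (c \<odot>\<^bsub>A\<^esub> y) = c \<odot>\<^bsub>A\<^esub> (x \<otimes>\<^bsub>A\<^esub> y)"

definition bilinear_form ::
  "('k, 'm) ring_scheme \<Rightarrow> ('k, 'a, 'n) module_scheme \<Rightarrow> ('a \<Rightarrow> 'a \<Rightarrow> 'k) \<Rightarrow> bool" where
  "bilinear_form K A B \<longleftrightarrow>
     (\<forall>x\<in>carrier A. \<forall>y\<in>carrier A. B x y \<in> carrier K) \<and>
     (\<forall>x\<in>carrier A. \<forall>y\<in>carrier A. \<forall>z\<in>carrier A.
        B (x \<oplus>\<^bsub>A\<^esub> y) z = B x z \<oplus>\<^bsub>K\<^esub> B y z \<and>
        B z (x \<oplus>\<^bsub>A\<^esub> y) = B z x \<oplus>\<^bsub>K\<^esub> B z y) \<and>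
     (\<forall>c\<in>carrier K. \<forall>x\<in>carrier A. \<forall>y\<in>carrier A.
        B (c \<odot>\<^bsub>A\<^esub> x) y = c \<otimes>\<^bsub>K\<^esub> B x y \<and>
        B x (c \<odot>\<^bsub>A\<^esub> y) = c \<otimes>\<^bsub>K\<^esub> B x y)"

definition nondegenerate_form ::
  "('k, 'm) ring_scheme \<Rightarrow> ('k, 'a, 'n) module_scheme \<Rightarrow> ('a \<Rightarrow> 'a \<Rightarrow> 'k) \<Rightarrow> bool" where
  "nondegenerate_form K A B \<longleftrightarrow>
     (\<forall>x\<in>carrier A. (\<forall>y\<in>carrier A. B x y = \<zero>\<^bsub>K\<^esub>) \<longrightarrow> x = \<zero>\<^bsub>A\<^esub>) \<and>
     (\<forall>y\<in>carrier A. (\<forall>x\<in>carrier A. B x y = \<zero>\<^bsub>K\<^esub>) \<longrightarrow> y = \<zero>\<^bsub>A\<^esub>)"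

definition antisymmetric_form ::
  "('k, 'm) ring_scheme \<Rightarrow> ('k, 'a, 'n) module_scheme \<Rightarrow> ('a \<Rightarrow> 'a \<Rightarrow> 'k) \<Rightarrow> bool" where
  "antisymmetric_form K A B \<longleftrightarrow>
     (\<forall>x\<in>carrier A. \<forall>y\<in>carrier A. B x y = \<ominus>\<^bsub>K\<^esub> B y x)"

locale anti_Frobenius = assoc_algebra K A
  for K :: "('k, 'm) ring_scheme" and A :: "('k, 'a, 'n) module_scheme"
    and B :: "'a \<Rightarrow> 'a \<Rightarrow> 'k" +
  assumes bilinear: "bilinear_form K A B"
    and antisymmetric: "antisymmetric_form K A B"
    and nondegenerate: "nondegenerate_form K A B"
    and cyclic: "\<lbrakk>x \<in> carrier A; y \<in> carrier A; z \<in> carrier A\<rbrakk>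
      \<Longrightarrow> B x (y \<otimes>\<^bsub>A\<^esub> z) \<oplus>\<^bsub>K\<^esub> B y (z \<otimes>\<^bsub>A\<^esub> x) \<oplus>\<^bsub>K\<^esub> B z (x \<otimes>\<^bsub>A\<^esub> y) = \<zero>\<^bsub>K\<^esub>"

(* Matrices of type mat are indexed from 0; entry and diag1 use indices 1, ..., N. *)
definition entry :: "'k mat \<Rightarrow> nat \<Rightarrow> nat \<Rightarrow> 'k" where
  "entry X i j = X $$ (i - 1, j - 1)"

definition diag1 :: "nat \<Rightarrow> (nat \<Rightarrow> 'k::zero) \<Rightarrow> 'k mat" where
  "diag1 N l = mat_diag N (\<lambda>i. l (i + 1))"

definition mat_trace :: "'k::comm_monoid_add mat \<Rightarrow> 'k" where
  "mat_trace X = (\<Sum>i<dim_row X. X $$ (i, i))"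

definition mat_commutator :: "'k::ring mat \<Rightarrow> 'k mat \<Rightarrow> 'k mat" where
  "mat_commutator X Y = X * Y - Y * X"

definition alg_NM :: "nat \<Rightarrow> nat \<Rightarrow> ('k::field, 'k mat) module" where
  "alg_NM N M = (module_mat TYPE('k) N N)
     \<lparr>carrier := {X \<in> carrier_mat N N.
        \<forall>r\<in>{1..M}. \<forall>j\<in>{1..N}. (\<Sum>i | i \<in> {1..N} \<and> [i = r] (mod M). entry X i j) = 0}\<rparr>"

definition trace_form :: "nat \<Rightarrow> (nat \<Rightarrow> 'k::field) \<Rightarrow> 'k mat \<Rightarrow> 'k mat \<Rightarrow> 'k" where
  "trace_form N l x y = mat_trace (mat_commutator x y * diag1 N l)"

end

theory Submission
  imports Defs
begin

text \<open>
  Write \<open>D\<close> for \<open>diag(\<lambda>_1, \<dots>, \<lambda>_N)\<close>. The functional \<open>\<tau>(u) = tr(u D)\<close> is linear and the form is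
  \<open>(x, y) = \<tau>(xy) - \<tau>(yx)\<close>, so bilinearity, antisymmetry and the cyclic identity hold for any
  linear \<open>\<tau>\<close> on any associative algebra (\<open>trace_form_eq\<close>); only nondegeneracy depends on the
  choice of \<open>\<lambda>\<close>, and by antisymmetry it suffices to treat the left kernel.

  The algebra consists of the matrices all of whose columns lie in the space \<open>V\<close> of vectors
  with vanishing sum over every residue class. If \<open>x\<close> is in the kernel of the form, pairing it
  with the matrices having the single nonzero column \<open>e_j - e_j'\<close>, where \<open>j\<close> and \<open>j'\<close> are
  congruent, shows that the entries \<open>(\<lambda>_i - \<lambda>_j) x_ij\<close> of \<open>[D, x]\<close> depend on \<open>j\<close> only modulo
  \<open>M\<close> (\<open>trace_form_column_difference\<close>).

  The integers \<open>1, \<dots>, N\<close> are cut into the blocks on which \<open>[i/M]\<close> is constant: a first one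
  \<open>{1, \<dots>, M-1}\<close>, a last one \<open>{N}\<close>, and between them complete residue systems.
  If the block of \<open>i\<close> meets the residue class of \<open>j\<close>, then \<open>(\<lambda>_i - \<lambda>_j) x_ij\<close> equals a
  term with \<open>\<lambda>_i = \<lambda>_j\<close>, hence vanishes. The rows for which this can fail belong to the first
  and the last block. The two blocks together form one complete residue system, so for
  such a row the residue class of \<open>j\<close> is represented in the opposite end block; in
  that column the vanishing sum over the class of \<open>i\<close> has no other nonzero term. Therefore
  \<open>[D, x] = 0\<close>, that is, \<open>x\<close> is block diagonal. A block and a residue class have at
  most one element in common, so every column sum now reduces to a single entry, and
  \<open>x = 0\<close> (\<open>residue_sums_zero_imp_zero\<close>).
\<close>

section \<open>The combinatorial core\<close>

lemma residue_sums_zero_imp_zero: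
  fixes x :: "nat \<Rightarrow> nat \<Rightarrow> 'k::field" and l :: "nat \<Rightarrow> 'k"
  assumes "N > 0" and "M dvd N"
    and l: "\<And>i j. \<lbrakk>i \<in> {1..N}; j \<in> {1..N}\<rbrakk> \<Longrightarrow> l i = l j \<longleftrightarrow> i div M = j div M"
    and sums: "\<And>r j. \<lbrakk>r \<in> {1..N}; j \<in> {1..N}\<rbrakk>
      \<Longrightarrow> (\<Sum>i | i \<in> {1..N} \<and> [i = r] (mod M). x i j) = 0"
    and periodic: "\<And>i j j'. \<lbrakk>i \<in> {1..N}; j \<in> {1..N}; j' \<in> {1..N}; [j = j'] (mod M)\<rbrakk>
      \<Longrightarrow> (l i - l j) * x i j = (l i - l j') * x i j'"
    and i: "i \<in> {1..N}" and j: "j \<in> {1..N}"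
  shows "x i j = 0"
proof -
  obtain n where n: "N = n * M" using \<open>M dvd N\<close> by (metis dvd_def mult.commute)
  have M: "M > 0" and n0: "n > 0" using \<open>N > 0\<close> n by (auto intro: Nat.gr0I)
  have N1: "N \<in> {1..N}" using \<open>N > 0\<close> by simp
  have NM: "N mod M = 0" "N div M = n" using n M by auto
  have MN: "M \<le> N" using n n0 by simp
  have same: "a = b" if "a mod M = b mod M" "a div M = b div M" for a b
    using that by (metis div_mult_mod_eq)
  have below: "a div M < n" if "a \<in> {1..N}" "a \<noteq> N" for a
    using that n M by (auto simp: less_mult_imp_div_less)
  have isolate: "x i j = 0" if ij: "i \<in> {1..N}" "j \<in> {1..N}"
    and others: "\<And>a. \<lbrakk>a \<in> {1..N}; a mod M = i mod M; a \<noteq> i\<rbrakk> \<Longrightarrow> x a j = 0" for i j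
  proof -
    have "(\<Sum>a | a \<in> {1..N} \<and> [a = i] (mod M). x a j) = (\<Sum>a\<in>{i}. x a j)"
      using ij others by (intro sum.mono_neutral_right) (auto simp: cong_def)
    then show ?thesis using sums[OF ij] by simp
  qed
  have transfer: "x i j = 0"
    if ij: "i \<in> {1..N}" "j \<in> {1..N}" "j' \<in> {1..N}" "j' mod M = j mod M"
      "i div M \<noteq> j div M" and zero: "i div M = j' div M \<or> x i j' = 0" for i j j'
  proof -
    have "(l i - l j') * x i j' = 0" using zero l[of i j'] ij by auto
    then have "(l i - l j) * x i j = 0" using periodic[of i j j'] ij by (simp add: cong_def)
    then show ?thesis using l[of i j] ij by auto
  qed
  have middle: "x i j = 0"
    if ij: "i \<in> {1..N}" "j \<in> {1..N}" "i div M \<noteq> 0" "i \<noteq> N" "i div M \<noteq> j div M" for i j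
  proof -
    \<comment> \<open>The block of \<open>i\<close> starts at a multiple of \<open>M\<close> and is complete, so it contains \<open>?j\<close>.\<close>
    let ?j = "(i div M) * M + j mod M"
    have "?j < (i div M + 1) * M" using M by simp
    also have "\<dots> \<le> n * M" using below[of i] ij by (intro mult_le_mono1) simp
    finally have "?j \<in> {1..N}" using ij M n by (auto simp: Suc_le_eq)
    then show ?thesis using M by (intro transfer[of i j ?j]) (use ij in auto)
  qed
  have block_diagonal: "x i j = 0"
    if ij: "i \<in> {1..N}" "j \<in> {1..N}" "i div M \<noteq> j div M" for i j
  proof -
    consider "i div M \<noteq> 0" "i \<noteq> N" | "i = N" | "i div M = 0" by blast
    then show ?thesis
    proof cases
      case 1
      then show ?thesis using middle ij by blast
    next
      case 2
      show ?thesis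
      proof (cases "j mod M = 0")
        case True
        then show ?thesis using transfer[of i j N] ij 2 NM N1 by simp
      next
        case False
        let ?j = "j mod M"
        have jM: "?j < M" using M by simp
        have j1: "?j \<in> {1..N}" using False jM MN by auto
        \<comment> \<open>Column \<open>?j\<close> is in the first block, while the multiples of \<open>M\<close> below \<open>N\<close> are
          in complete blocks; their rows vanish there.\<close>
        have "x N ?j = 0"
        proof (rule isolate[OF N1 j1])
          fix a assume a: "a \<in> {1..N}" "a mod M = N mod M" "a \<noteq> N"
          then have "a div M \<noteq> 0" using NM by (auto simp: div_eq_0_iff)
          then show "x a ?j = 0" using middle[of a ?j] a j1 jM by simp
        qed
        then show ?thesis using transfer[of i j ?j] ij 2 j1 by simp
      qed
    next
      case 3
      then have iM: "i < M" "i mod M = i" using M by (auto simp: div_eq_0_iff)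
      show ?thesis
      proof (cases "j mod M = 0")
        case False
        let ?j = "j mod M"
        have jM: "?j < M" using M by simp
        have j1: "?j \<in> {1..N}" using False jM MN by auto
        show ?thesis using transfer[of i j ?j] ij 3 j1 jM by simp
      next
        case True
        \<comment> \<open>No other member of the class of \<open>i\<close> is in an end block, so those rows vanish in
          column \<open>N\<close>.\<close>
        have "x i N = 0"
        proof (rule isolate[OF ij(1) N1])
          fix a assume a: "a \<in> {1..N}" "a mod M = i mod M" "a \<noteq> i"
          then have aN: "a \<noteq> N" using NM iM ij by auto
          have "a div M \<noteq> 0" using same[of a i] a 3 by auto
          then show "x a N = 0" using middle[of a N] a aN N1 NM below[of a] by simp
        qed
        then show ?thesis using transfer[of i j N] ij True NM N1 by simp
      qed
    qed
  qed
  show ?thesis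
  proof (cases "i div M = j div M")
    case True
    show ?thesis
    proof (rule isolate[OF i j])
      fix a assume a: "a \<in> {1..N}" "a mod M = i mod M" "a \<noteq> i"
      then have "a div M \<noteq> j div M" using same True by metis
      then show "x a j = 0" using block_diagonal a j by blast
    qed
  qed (use block_diagonal i j in blast)
qed

section \<open>The algebra\<close>

lemma entry_mult:
  assumes "X \<in> carrier_mat N N" and "Y \<in> carrier_mat N N" and "i \<in> {1..N}" and "j \<in> {1..N}"
  shows "entry (X * Y) i j = (\<Sum>a\<in>{1..N}. entry X i a * entry Y a j)"
proof -
  have "entry (X * Y) i j = (\<Sum>a = 0..<N. X $$ (i - 1, a) * Y $$ (a, j - 1))"
    using assms by (auto simp: entry_def scalar_prod_def)
  also have "\<dots> = (\<Sum>a\<in>{1..N}. entry X i a * entry Y a j)"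
    unfolding entry_def
    by (rule sum.reindex_bij_witness[of _ "\<lambda>a. a - 1" Suc]) auto
  finally show ?thesis .
qed

lemma entry_add:
  assumes "Y \<in> carrier_mat N N" and "i \<in> {1..N}" and "j \<in> {1..N}"
  shows "entry (X + Y) i j = entry X i j + entry Y i j"
  using assms by (auto simp: entry_def)

lemma entry_smult:
  assumes "X \<in> carrier_mat N N" and "i \<in> {1..N}" and "j \<in> {1..N}"
  shows "entry (c \<cdot>\<^sub>m X) i j = c * entry X i j"
  using assms by (auto simp: entry_def)

lemma entry_zero:
  assumes "i \<in> {1..N}" and "j \<in> {1..N}"
  shows "entry (0\<^sub>m N N) i j = 0"
  using assms by (auto simp: entry_def)

lemma mat_eq_zeroI:
  assumes "X \<in> carrier_mat N N" and "\<And>i j. \<lbrakk>i \<in> {1..N}; j \<in> {1..N}\<rbrakk> \<Longrightarrow> entry X i j = 0"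
  shows "X = 0\<^sub>m N N"
proof (rule eq_matI)
  fix i j assume "i < dim_row (0\<^sub>m N N)" "j < dim_col (0\<^sub>m N N)"
  then show "X $$ (i, j) = 0\<^sub>m N N $$ (i, j)"
    using assms(2)[of "Suc i" "Suc j"] by (auto simp: entry_def)
qed (use assms(1) in auto)

lemma alg_NM_simps:
  "monoid.mult (alg_NM N M) = (*)" "add (alg_NM N M) = (+)" "zero (alg_NM N M) = 0\<^sub>m N N"
  "smult (alg_NM N M) = (\<cdot>\<^sub>m)"
  by (simp_all add: alg_NM_def module_mat_simps)

lemma mem_alg_NM:
  "X \<in> carrier (alg_NM N M) \<longleftrightarrow> X \<in> carrier_mat N N \<and>
     (\<forall>r\<in>{1..M}. \<forall>j\<in>{1..N}. (\<Sum>i | i \<in> {1..N} \<and> [i = r] (mod M). entry X i j) = 0)"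
  by (simp add: alg_NM_def)

lemma alg_NM_carrier_mat: "X \<in> carrier (alg_NM N M) \<Longrightarrow> X \<in> carrier_mat N N"
  by (simp add: mem_alg_NM)

lemma alg_NM_residue_sum:
  assumes "X \<in> carrier (alg_NM N M)" and "M > 0" and "j \<in> {1..N}"
  shows "(\<Sum>i | i \<in> {1..N} \<and> [i = r] (mod M). entry X i j) = 0"
proof -
  \<comment> \<open>The representative of \<open>r\<close> in \<open>{1..M}\<close>; for the zero class it is \<open>M\<close>.\<close>
  define s where "s = (if r mod M = 0 then M else r mod M)"
  have "s \<in> {1..M}" "[s = r] (mod M)"
    using \<open>M > 0\<close> by (auto simp: s_def cong_def less_imp_le Suc_le_eq)
  moreover from this(2) have "[i = r] (mod M) \<longleftrightarrow> [i = s] (mod M)" for i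
    by (auto simp: cong_def)
  ultimately show ?thesis using assms by (simp add: mem_alg_NM)
qed

text \<open>The columns of \<open>X * Y\<close> are linear combinations of those of \<open>X\<close>, so the algebra is even a
  right ideal of the full matrix algebra.\<close>

lemma alg_NM_mult_closed:
  assumes X: "X \<in> carrier (alg_NM N M)" and Y: "Y \<in> carrier_mat N N"
  shows "X * Y \<in> carrier (alg_NM N M)"
proof -
  have Xc: "X \<in> carrier_mat N N" using X by (rule alg_NM_carrier_mat)
  have "(\<Sum>i | i \<in> {1..N} \<and> [i = r] (mod M). entry (X * Y) i j) = 0"
    if r: "r \<in> {1..M}" and j: "j \<in> {1..N}" for r j
  proof -
    let ?S = "{i. i \<in> {1..N} \<and> [i = r] (mod M)}"
    have "(\<Sum>i\<in>?S. entry (X * Y) i j) = (\<Sum>i\<in>?S. \<Sum>a\<in>{1..N}. entry X i a * entry Y a j)"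
      using Xc Y j by (intro sum.cong refl entry_mult) auto
    also have "\<dots> = (\<Sum>a\<in>{1..N}. (\<Sum>i\<in>?S. entry X i a) * entry Y a j)"
      by (subst sum.swap) (simp only: sum_distrib_right)
    also have "\<dots> = 0" using X r by (intro sum.neutral) (simp add: mem_alg_NM)
    finally show ?thesis .
  qed
  then show ?thesis using Xc Y by (auto simp: mem_alg_NM)
qed

lemma alg_NM_add_closed:
  assumes X: "X \<in> carrier (alg_NM N M)" and Y: "Y \<in> carrier (alg_NM N M)"
  shows "X + Y \<in> carrier (alg_NM N M)"
proof -
  have "(\<Sum>i | i \<in> {1..N} \<and> [i = r] (mod M). entry (X + Y) i j) = 0"
    if r: "r \<in> {1..M}" and j: "j \<in> {1..N}" for r j
  proof -
    let ?S = "{i. i \<in> {1..N} \<and> [i = r] (mod M)}"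
    have "(\<Sum>i\<in>?S. entry (X + Y) i j) = (\<Sum>i\<in>?S. entry X i j + entry Y i j)"
      using Y j by (intro sum.cong refl entry_add[of _ N] alg_NM_carrier_mat) auto
    then show ?thesis using X Y r j by (simp add: mem_alg_NM sum.distrib)
  qed
  then show ?thesis using X Y by (auto simp: mem_alg_NM)
qed

lemma alg_NM_smult_closed:
  assumes X: "X \<in> carrier (alg_NM N M)"
  shows "c \<cdot>\<^sub>m X \<in> carrier (alg_NM N M)"
proof -
  have "(\<Sum>i | i \<in> {1..N} \<and> [i = r] (mod M). entry (c \<cdot>\<^sub>m X) i j) = 0"
    if r: "r \<in> {1..M}" and j: "j \<in> {1..N}" for r j
  proof -
    let ?S = "{i. i \<in> {1..N} \<and> [i = r] (mod M)}"
    have "(\<Sum>i\<in>?S. entry (c \<cdot>\<^sub>m X) i j) = (\<Sum>i\<in>?S. c * entry X i j)"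
      using X j by (intro sum.cong refl entry_smult[of _ N] alg_NM_carrier_mat) auto
    then show ?thesis using X r j by (simp add: mem_alg_NM flip: sum_distrib_left)
  qed
  then show ?thesis using X by (auto simp: mem_alg_NM)
qed

lemma alg_NM_vectorspace:
  "vectorspace class_ring (alg_NM N M :: ('k::field, 'k mat) module)"
proof -
  let ?V = "module_mat TYPE('k) N N" and ?W = "carrier (alg_NM N M :: ('k, 'k mat) module)"
  interpret V: vectorspace "class_ring :: 'k ring" ?V by (rule matrix_vs)
  have "0\<^sub>m N N \<in> ?W" by (auto simp: mem_alg_NM entry_zero)
  then have "submodule class_ring ?W ?V"
    by (intro submodule.intro V.module_axioms)
      (auto simp: module_mat_simps alg_NM_carrier_mat alg_NM_add_closed alg_NM_smult_closed)
  then have "vectorspace class_ring (?V\<lparr>carrier := ?W\<rparr>)"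
    by (intro V.subspace_is_vs) (simp add: VectorSpace.subspace_def V.vectorspace_axioms)
  then show ?thesis by (simp add: alg_NM_def)
qed

lemma alg_NM_assoc_algebra:
  "assoc_algebra class_ring (alg_NM N M :: ('k::field, 'k mat) module)"
proof (intro assoc_algebra.intro alg_NM_vectorspace assoc_algebra_axioms.intro, goal_cases)
  case (1 x y)
  then show ?case by (simp add: alg_NM_simps alg_NM_mult_closed alg_NM_carrier_mat)
next
  case (2 x y z)
  then show ?case by (auto simp: alg_NM_simps dest!: alg_NM_carrier_mat)
next
  case (3 x y z)
  then show ?case
    by (auto simp: alg_NM_simps add_mult_distrib_mat dest!: alg_NM_carrier_mat)
next
  case (4 x y z)
  then show ?case
    by (auto simp: alg_NM_simps mult_add_distrib_mat dest!: alg_NM_carrier_mat)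
next
  case (5 c x y)
  then show ?case
    by (auto simp: alg_NM_simps mult_smult_assoc_mat dest!: alg_NM_carrier_mat)
next
  case (6 c x y)
  then show ?case
    by (auto simp: alg_NM_simps mult_smult_distrib dest!: alg_NM_carrier_mat)
qed

section \<open>The form\<close>

definition weighted_trace :: "nat \<Rightarrow> (nat \<Rightarrow> 'k::field) \<Rightarrow> 'k mat \<Rightarrow> 'k" where
  "weighted_trace N l u = (\<Sum>i\<in>{1..N}. l i * entry u i i)"

lemma weighted_trace_add:
  assumes "v \<in> carrier_mat N N"
  shows "weighted_trace N l (u + v) = weighted_trace N l u + weighted_trace N l v"
  using assms by (simp add: weighted_trace_def entry_add[of _ N] distrib_left sum.distrib)

lemma weighted_trace_smult:
  assumes "u \<in> carrier_mat N N"
  shows "weighted_trace N l (c \<cdot>\<^sub>m u) = c * weighted_trace N l u"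
  using assms by (simp add: weighted_trace_def entry_smult[of _ N] sum_distrib_left ac_simps)

text \<open>This presents the form as the commutator followed by a linear functional, which is all
  that its formal properties require.\<close>

lemma trace_form_eq:
  assumes x: "x \<in> carrier_mat N N" and y: "y \<in> carrier_mat N N"
  shows "trace_form N l x y = weighted_trace N l (x * y) - weighted_trace N l (y * x)"
proof -
  have c: "x * y \<in> carrier_mat N N" "y * x \<in> carrier_mat N N" using x y by auto
  have "trace_form N l x y
      = (\<Sum>i<N. l (Suc i) * ((x * y) $$ (i, i) - (y * x) $$ (i, i)))"
    using x y c minus_carrier_mat[OF c(2)]
    unfolding trace_form_def mat_trace_def mat_commutator_def diag1_def
    by (subst mat_diag_mult_right[of _ N N])
       (auto intro!: sum.cong simp: mult.commute simp del: index_mult_mat(1))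
  also have "\<dots> = (\<Sum>i\<in>{1..N}. l i * (entry (x * y) i i - entry (y * x) i i))"
    unfolding entry_def
    by (rule sum.reindex_bij_witness[of _ "\<lambda>a. a - 1" Suc]) auto
  finally show ?thesis
    by (simp add: weighted_trace_def right_diff_distrib sum_subtractf)
qed

lemma trace_form_bilinear: "bilinear_form class_ring (alg_NM N M) (trace_form N l)"
  unfolding bilinear_form_def
  by (auto simp: alg_NM_simps trace_form_eq[of _ N] weighted_trace_add weighted_trace_smult
        add_mult_distrib_mat[of _ N N] mult_add_distrib_mat[of _ N N]
        mult_smult_assoc_mat[of _ N N] mult_smult_distrib[of _ N N] algebra_simps
      dest!: alg_NM_carrier_mat)

lemma trace_form_antisym:
  assumes "x \<in> carrier_mat N N" and "y \<in> carrier_mat N N"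
  shows "trace_form N l x y = - trace_form N l y x"
  using assms by (simp add: trace_form_eq)

lemma trace_form_cyclic:
  assumes "x \<in> carrier_mat N N" and "y \<in> carrier_mat N N" and "z \<in> carrier_mat N N"
  shows "trace_form N l x (y * z) + trace_form N l y (z * x) + trace_form N l z (x * y) = 0"
  using assms by (simp add: trace_form_eq[of _ N] assoc_mult_mat[of _ N N _ N _ N])

text \<open>The test matrix has column \<open>p\<close> equal to \<open>e_j - e_j'\<close> and zeros elsewhere. It lies in the
  algebra because the two indices are in the same residue class.\<close>

lemma trace_form_column_difference:
  fixes x :: "'k::field mat"
  assumes x: "x \<in> carrier_mat N N"
    and p: "p \<in> {1..N}" and j: "j \<in> {1..N}" and j': "j' \<in> {1..N}"
    and cong: "[j = j'] (mod M)"
  obtains y where "y \<in> carrier (alg_NM N M)"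
    and "trace_form N l x y
      = (l p - l j) * entry x p j - (l p - l j') * entry x p j'"
proof
  define e :: "nat \<Rightarrow> 'k" where
    "e a = (if a = j then 1 else 0) - (if a = j' then 1 else 0)" for a
  define y where "y = mat N N (\<lambda>(a, b). if Suc b = p then e (Suc a) else 0)"
  have y: "y \<in> carrier_mat N N" by (simp add: y_def)
  have entry_y: "entry y a b = (if b = p then e a else 0)"
    if "a \<in> {1..N}" "b \<in> {1..N}" for a b
    using that by (auto simp: entry_def y_def)
  have sum_e: "(\<Sum>a\<in>{1..N}. f a * e a) = f j - f j'" for f
  proof -
    have "f a * e a = (if a = j then f a else 0) - (if a = j' then f a else 0)" for a
      by (simp add: e_def)
    then show ?thesis using j j' by (simp add: sum_subtractf)
  qed
  have "(\<Sum>i | i \<in> {1..N} \<and> [i = r] (mod M). entry y i b) = 0" if b: "b \<in> {1..N}" for r b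
  proof (cases "b = p")
    case True
    have "(\<Sum>i | i \<in> {1..N} \<and> [i = r] (mod M). entry y i b)
        = (\<Sum>i | i \<in> {1..N} \<and> [i = r] (mod M). e i)"
      using True b by (intro sum.cong) (auto simp: entry_y)
    also have "\<dots> = (\<Sum>i\<in>{1..N}. of_bool ([i = r] (mod M)) * e i)"
      by (intro sum.mono_neutral_cong_left) auto
    also have "\<dots> = 0" using cong by (subst sum_e) (auto simp: cong_def)
    finally show ?thesis .
  next
    case False
    then show ?thesis using b by (intro sum.neutral) (auto simp: entry_y)
  qed
  then show "y \<in> carrier (alg_NM N M)" using y by (simp add: mem_alg_NM)
  have "weighted_trace N l (x * y)
      = (\<Sum>i\<in>{1..N}. if i = p then l i * (\<Sum>a\<in>{1..N}. entry x i a * e a) else 0)"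
    unfolding weighted_trace_def
    by (intro sum.cong) (auto simp: entry_mult[OF x y] entry_y)
  also have "\<dots> = l p * (entry x p j - entry x p j')" using p by (simp add: sum_e[simplified])
  finally have 1: "weighted_trace N l (x * y) = l p * (entry x p j - entry x p j')" .
  have "entry (y * x) i i = e i * entry x p i" if i: "i \<in> {1..N}" for i
  proof -
    have "entry (y * x) i i = (\<Sum>a\<in>{1..N}. if a = p then e i * entry x a i else 0)"
      unfolding entry_mult[OF y x i i] using i by (intro sum.cong) (auto simp: entry_y)
    then show ?thesis using p by simp
  qed
  then have "weighted_trace N l (y * x) = (\<Sum>i\<in>{1..N}. (l i * entry x p i) * e i)"
    unfolding weighted_trace_def by (intro sum.cong) auto
  then have 2: "weighted_trace N l (y * x) = l j * entry x p j - l j' * entry x p j'"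
    by (simp only: sum_e)
  show "trace_form N l x y = (l p - l j) * entry x p j - (l p - l j') * entry x p j'"
    by (simp add: trace_form_eq[OF x y] 1 2 algebra_simps)
qed

lemma trace_form_left_kernel:
  fixes l :: "nat \<Rightarrow> 'k::field"
  assumes "N > 0" and "M dvd N"
    and l: "\<forall>i\<in>{1..N}. \<forall>j\<in>{1..N}. l i = l j \<longleftrightarrow> i div M = j div M"
    and x: "x \<in> carrier (alg_NM N M)"
    and kernel: "\<And>y. y \<in> carrier (alg_NM N M) \<Longrightarrow> trace_form N l x y = 0"
  shows "x = 0\<^sub>m N N"
proof (rule mat_eq_zeroI)
  show xc: "x \<in> carrier_mat N N" using x by (rule alg_NM_carrier_mat)
  have M: "M > 0" using assms(1,2) by (auto intro: Nat.gr0I)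
  fix i j assume ij: "i \<in> {1..N}" "j \<in> {1..N}"
  show "entry x i j = 0"
  proof (rule residue_sums_zero_imp_zero[OF assms(1,2) _ _ _ ij])
    fix p j j' assume "p \<in> {1..N}" "j \<in> {1..N}" "j' \<in> {1..N}" "[j = j'] (mod M)"
    then obtain y where "y \<in> carrier (alg_NM N M)"
      "trace_form N l x y = (l p - l j) * entry x p j - (l p - l j') * entry x p j'"
      using trace_form_column_difference[OF xc] by blast
    then show "(l p - l j) * entry x p j = (l p - l j') * entry x p j'"
      using kernel by simp
  qed (use l x M alg_NM_residue_sum in blast)+
qed

theorem mainTheorem1:
  fixes N M :: nat and l :: "nat \<Rightarrow> 'k::field"
  assumes "N > 0" and "M dvd N" and "M < N"
    and "\<forall>i\<in>{1..N}. \<forall>j\<in>{1..N}. l i = l j \<longleftrightarrow> i div M = j div M"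
  shows "nondegenerate_form class_ring (alg_NM N M :: ('k, 'k mat) module) (trace_form N l)
    \<and> anti_Frobenius class_ring (alg_NM N M :: ('k, 'k mat) module) (trace_form N l)"
proof
  let ?A = "alg_NM N M :: ('k, 'k mat) module"
  note left = trace_form_left_kernel[OF assms(1,2,4)]
  have right: "y = 0\<^sub>m N N"
    if "y \<in> carrier ?A" "\<forall>x\<in>carrier ?A. trace_form N l x y = 0" for y
    using that by (intro left) (auto simp: trace_form_antisym[of y] alg_NM_carrier_mat)
  show nondeg: "nondegenerate_form class_ring ?A (trace_form N l)"
    unfolding nondegenerate_form_def using left right by (auto simp: alg_NM_simps)
  show "anti_Frobenius class_ring ?A (trace_form N l)"
  proof (intro anti_Frobenius.intro alg_NM_assoc_algebra anti_Frobenius_axioms.intro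
      trace_form_bilinear nondeg)
    show "antisymmetric_form class_ring ?A (trace_form N l)"
      unfolding antisymmetric_form_def class_ring_simps
      using trace_form_antisym alg_NM_carrier_mat by blast
  next
    fix x y z assume "x \<in> carrier ?A" "y \<in> carrier ?A" "z \<in> carrier ?A"
    then show "trace_form N l x (y \<otimes>\<^bsub>?A\<^esub> z) \<oplus>\<^bsub>class_ring\<^esub> trace_form N l y (z \<otimes>\<^bsub>?A\<^esub> x)
        \<oplus>\<^bsub>class_ring\<^esub> trace_form N l z (x \<otimes>\<^bsub>?A\<^esub> y) = \<zero>\<^bsub>class_ring\<^esub>"
      by (simp add: alg_NM_simps trace_form_cyclic alg_NM_carrier_mat)
  qed
qed

end
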